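(* Let $l\ge 1$, let $G$ be an abelian group and let $V$ be a $G$-valued Vassiliev (finite type) invariant of oriented framed $l$-component links with ordered components in $S^3$. Then for every symmetric integer $l\times l$ matrix $P$, the restriction of $V$ to the class of links with linking matrix $P$ is a linking class-$P$ invariant of finite type, both in the DD sense and in the $\bigwedge$ sense.
   Context: Links are framed, oriented, with ordered components, in $S^3$, up to isotopy. The linking matrix $P$ of a link has as off-diagonal entries the pairwise linking numbers and as diagonal entries the framings. Links are drawn by diagrams with blackboard framing. A $P$-link is a link with linking matrix $P$. Vassiliev invariants: a link invariant is extended to links with finitely many transverse double points by $V(\text{double point})=V(\text{positive crossing})-V(\text{negative crossing})$; $V$ is a Vassiliev invariant of type $n$ if it vanishes on all links with more than $n$ double points, and it is a Vassiliev invariant if it is of type $n$ for some $n$. DD-singular links: a $DD^{m}$-singular $P$-link is a link with $2m$ transverse double points grouped into $m$ pairs. In each pair one double point is labelled $+$ and the other $-$, and both are intersections between the same two components $i$ and $j$ (possibly $i=j$). Resolving a pair means replacing the singular link $L$ by one of two links. In $\overline{L}$ the $+$ double point becomes a positive crossing and the $-$ double point a negative crossing; in $\underline{L}$ the $+$ double point becomes a negative crossing and the $-$ double point a positive crossing. It is required that resolving all pairs in this way gives links with linking matrix $P$. $\bigwedge$-singular links: a $\bigwedge^{m}$-singular $P$-link is a $DD^{m}$-singular $P$-link in which every pair is close. That is, the link is drawn so that for each pair there is a segment of one of the components, running from one double point of the pair to the other, which meets no other crossing or double point in its interior (as drawn in the paper, along the orientation of this segment the $-$ double point comes first and the $+$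 double point second; exchanging the labels of a pair only changes the sign of the extended invariant). An invariant $V$ of $P$-links is extended to $DD^m$- and $\bigwedge^m$-singular $P$-links by repeatedly using $V(L)=V(\overline L)-V(\underline L)$ for each pair. $V$ is a DD (respectively $\bigwedge$) linking class-$P$ invariant of finite type if there is some positive integer $m$ such that it vanishes on all $DD^{m}$-singular (respectively all $\bigwedge^{m}$-singular) $P$-links. *)

theory Defs
  imports "HOL-Analysis.Analysis"
begin

section \<open>Framed singular links in the 3-sphere\<close>

text \<open>
  The class \<open>C\<^sup>k\<close>, via iterated directional derivatives; the domains used below are
  \<open>real\<close> and \<open>real \<times> real\<close>.
\<close>

primrec Ck :: "nat \<Rightarrow> ('a::real_normed_vector \<Rightarrow> 'b::real_normed_vector) \<Rightarrow> bool" where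
  "Ck 0 f \<longleftrightarrow> continuous_on UNIV f"
| "Ck (Suc k) f \<longleftrightarrow> (\<forall>x. f differentiable (at x)) \<and>
     (\<forall>v. Ck k (\<lambda>x. frechet_derivative f (at x) v))"

definition smooth :: "('a::real_normed_vector \<Rightarrow> 'b::real_normed_vector) \<Rightarrow> bool" where
  "smooth f \<longleftrightarrow> (\<forall>k. Ck k f)"

definition indep2 :: "'a::real_vector \<Rightarrow> 'a \<Rightarrow> bool" where
  "indep2 u v \<longleftrightarrow> u \<noteq> v \<and> independent {u, v}"

text \<open>
  The ordered components are indexed by a finite type \<open>'l\<close>, so \<open>l = CARD('l) \<ge> 1\<close>.
  Component \<open>i\<close> is a map of period 1 sending \<open>t\<close> to the pair of its position in the unit
  sphere of \<open>real^4\<close> and its framing vector there.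
\<close>

type_synonym 'l framed_curves = "'l \<Rightarrow> real \<Rightarrow> (real^4) \<times> (real^4)"

definition pos :: "'l framed_curves \<Rightarrow> 'l \<Rightarrow> real \<Rightarrow> real^4" where
  "pos L i t = fst (L i t)"

definition framing :: "'l framed_curves \<Rightarrow> 'l \<Rightarrow> real \<Rightarrow> real^4" where
  "framing L i t = snd (L i t)"

definition velocity :: "'l framed_curves \<Rightarrow> 'l \<Rightarrow> real \<Rightarrow> real^4" where
  "velocity L i t = vector_derivative (pos L i) (at t)"

definition framed_immersion :: "('l::finite) framed_curves \<Rightarrow> bool" where
  "framed_immersion L \<longleftrightarrow>
     (\<forall>i. smooth (L i) \<and>
       (\<forall>t. L i (t + 1) = L i t \<and> norm (pos L i t) = 1 \<and>
            pos L i t \<bullet> framing L i t = 0 \<and> indep2 (velocity L i t) (framing L i t)))"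

text \<open>
  The points of the \<open>l\<close> source circles are the pairs \<open>(i, t)\<close> with \<open>0 \<le> t < 1\<close>. A double
  point is the unordered pair of the two source points it comes from.
\<close>

type_synonym 'l double_point = "('l \<times> real) set"

definition source_points :: "('l \<times> real) set" where
  "source_points = UNIV \<times> {0..<1}"

definition self_intersections :: "('l \<times> real \<Rightarrow> 'a) \<Rightarrow> 'l double_point set" where
  "self_intersections f =
     {{p, q} | p q. p \<in> source_points \<and> q \<in> source_points \<and> p \<noteq> q \<and> f p = f q}"

definition double_points :: "'l framed_curves \<Rightarrow> 'l double_point set" where
  "double_points L = self_intersections (\<lambda>(i, t). pos L i t)"

text \<open>Disjointness of the double points excludes triple points.\<close>

definition singular_link :: "('l::finite) framed_curves \<Rightarrow> bool" where
  "singular_link L \<longleftrightarrow> framed_immersion L \<and> finite (double_points L) \<and>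
     disjoint (double_points L) \<and>
     (\<forall>i s j t. {(i, s), (j, t)} \<in> double_points L \<longrightarrow>
        indep2 (velocity L i s) (velocity L j t))"

definition framed_link :: "('l::finite) framed_curves \<Rightarrow> bool" where
  "framed_link L \<longleftrightarrow> singular_link L \<and> double_points L = {}"

definition smooth_family :: "(real \<Rightarrow> 'l framed_curves) \<Rightarrow> bool" where
  "smooth_family H \<longleftrightarrow> (\<forall>i. smooth (\<lambda>(e, t). H e i t))"

text \<open>
  Isotopy of singular links. Keeping the parameters of the double points constant is a
  normalisation (source circles may be reparametrised along the isotopy); it makes labels of
  double points carry over. For links without double points this is smooth isotopy.
\<close>

definition isotopic :: "('l::finite) framed_curves \<Rightarrow> 'l framed_curves \<Rightarrow> bool" where
  "isotopic L L' \<longleftrightarrow> (\<exists>H. smooth_family H \<and> H 0 = L \<and> H 1 = L' \<and>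
     (\<forall>e\<in>{0..1}. singular_link (H e) \<and> double_points (H e) = double_points L))"


section \<open>Linking matrix\<close>

text \<open>
  Stereographic projection from the north pole. It preserves orientation when the sphere is
  oriented as the boundary of the ball: \<open>(u, v, w)\<close> is a positive basis of the tangent
  space at \<open>x\<close> iff \<open>det (vector [x, u, v, w]) > 0\<close>.
\<close>

definition north_pole :: "real^4" where
  "north_pole = axis 4 1"

definition stereo :: "real^4 \<Rightarrow> real^3" where
  "stereo x = (1 / (1 - x$4)) *\<^sub>R vector [x$1, x$2, x$3]"

definition gauss_integral :: "(real \<Rightarrow> real^3) \<Rightarrow> (real \<Rightarrow> real^3) \<Rightarrow> real" where
  "gauss_integral a b = 1 / (4 * pi) *
     integral ({0..1} \<times> {0..1}) (\<lambda>(s, t).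
       (cross3 (vector_derivative a (at s)) (vector_derivative b (at t)) \<bullet> (a s - b t))
         / norm (a s - b t) ^ 3)"

text \<open>
  The rotation moves the two curves off the north pole; the value does not depend on it.
\<close>

definition has_linking_number :: "(real \<Rightarrow> real^4) \<Rightarrow> (real \<Rightarrow> real^4) \<Rightarrow> int \<Rightarrow> bool" where
  "has_linking_number a b n \<longleftrightarrow>
     (\<exists>A::real^4^4. rotation_matrix A \<and>
       (\<forall>t. A *v a t \<noteq> north_pole \<and> A *v b t \<noteq> north_pole) \<and>
       gauss_integral (\<lambda>t. stereo (A *v a t)) (\<lambda>t. stereo (A *v b t)) = of_int n)"

definition pushoff :: "'l framed_curves \<Rightarrow> 'l \<Rightarrow> real \<Rightarrow> real \<Rightarrow> real^4" where
  "pushoff L i e t = sgn (pos L i t + e *\<^sub>R framing L i t)"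

definition has_linking_matrix :: "('l::finite) framed_curves \<Rightarrow> int^'l^'l \<Rightarrow> bool" where
  "has_linking_matrix L P \<longleftrightarrow>
     (\<forall>i j. i \<noteq> j \<longrightarrow> has_linking_number (pos L i) (pos L j) (P$i$j)) \<and>
     (\<forall>i. \<forall>\<^sub>F e in at_right 0. has_linking_number (pos L i) (pushoff L i e) (P$i$i))"

definition P_links :: "int^'l^'l \<Rightarrow> ('l::finite) framed_curves set" where
  "P_links P = {L. framed_link L \<and> has_linking_matrix L P}"


section \<open>Resolving double points\<close>

text \<open>
  \<open>crossing_change d Lm L Lp\<close>: the double point \<open>d\<close> of \<open>L\<close> is replaced by a positive crossing
  in \<open>Lp\<close> and by a negative crossing in \<open>Lm\<close>. This is expressed by a smooth family from \<open>Lm\<close>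
  to \<open>Lp\<close> which pulls the two strands apart at \<open>d\<close>, passes through \<open>L\<close> at time 0 and leaves
  the remaining double points alone. A crossing is positive iff
  (tangent of one strand, tangent of the other strand, vector from the latter to the former)
  is a positive basis; so the determinant below says that the family passes at \<open>L\<close> from the
  negative to the positive side. It does not depend on the order of the two strands.
  The framing moves along continuously, as blackboard framings of diagrams do.
\<close>

definition crossing_change ::
  "'l double_point \<Rightarrow> ('l::finite) framed_curves \<Rightarrow> 'l framed_curves \<Rightarrow> 'l framed_curves \<Rightarrow> bool" where
  "crossing_change d Lm L Lp \<longleftrightarrow> d \<in> double_points L \<and>
     (\<exists>H. smooth_family H \<and> H (-1) = Lm \<and> H 0 = L \<and> H 1 = Lp \<and>
       (\<forall>e\<in>{-1..1}. singular_link (H e) \<and>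
          (e \<noteq> 0 \<longrightarrow> double_points (H e) = double_points L - {d})) \<and>
       (\<exists>i s j t. d = {(i, s), (j, t)} \<and>
          det (vector [pos L i s, velocity L i s, velocity L j t,
                 vector_derivative (\<lambda>e. pos (H e) i s - pos (H e) j t) (at 0)] :: real^4^4) > 0))"

text \<open>
  A state assigns to each double point of \<open>L\<close> the value \<open>0\<close> (kept), \<open>1\<close> (replaced by a
  positive crossing) or \<open>-1\<close> (replaced by a negative crossing). A resolution of \<open>L\<close> is a
  choice of the singular links \<open>R \<sigma>\<close> which arise by making these replacements independently
  of each other, as one obtains by modifying \<open>L\<close> inside disjoint small balls around its double
  points. Each \<open>R \<sigma>\<close> is determined by \<open>L\<close> and \<open>\<sigma>\<close> up to isotopy.
\<close>

type_synonym 'l state = "'l double_point \<Rightarrow> int"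

definition all_kept :: "'l framed_curves \<Rightarrow> 'l state" where
  "all_kept L = (\<lambda>d\<in>double_points L. 0)"

definition is_resolution ::
  "('l::finite) framed_curves \<Rightarrow> ('l state \<Rightarrow> 'l framed_curves) \<Rightarrow> bool" where
  "is_resolution L R \<longleftrightarrow> R (all_kept L) = L \<and>
     (\<forall>\<sigma> \<in> double_points L \<rightarrow>\<^sub>E {-1, 0, 1}. \<forall>d\<in>double_points L. \<sigma> d = 0 \<longrightarrow>
        crossing_change d (R (\<sigma>(d := -1))) (R \<sigma>) (R (\<sigma>(d := 1))))"


section \<open>Vassiliev invariants\<close>

definition link_invariant :: "(('l::finite) framed_curves \<Rightarrow> 'g) \<Rightarrow> bool" where
  "link_invariant V \<longleftrightarrow> (\<forall>L L'. framed_link L \<and> framed_link L' \<and> isotopic L L' \<longrightarrow> V L = V L')"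

text \<open>
  \<open>vassiliev_value V R D \<sigma> x\<close>: the extension of \<open>V\<close> to singular links takes the value \<open>x\<close>
  at \<open>R \<sigma>\<close>, where \<open>R\<close> is a resolution of a singular link with set of double points \<open>D\<close>.
\<close>

inductive vassiliev_value ::
  "('l framed_curves \<Rightarrow> 'g::ab_group_add) \<Rightarrow> ('l state \<Rightarrow> 'l framed_curves) \<Rightarrow>
   'l double_point set \<Rightarrow> 'l state \<Rightarrow> 'g \<Rightarrow> bool"
  for V R D where
  resolved: "\<sigma> \<in> D \<rightarrow>\<^sub>E {-1, 1} \<Longrightarrow> vassiliev_value V R D \<sigma> (V (R \<sigma>))"
| double_point: "d \<in> D \<Longrightarrow> \<sigma> d = 0 \<Longrightarrow>
    vassiliev_value V R D (\<sigma>(d := 1)) x \<Longrightarrow> vassiliev_value V R D (\<sigma>(d := -1)) y \<Longrightarrow>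
    vassiliev_value V R D \<sigma> (x - y)"

definition vassiliev_of_type :: "nat \<Rightarrow> (('l::finite) framed_curves \<Rightarrow> 'g::ab_group_add) \<Rightarrow> bool" where
  "vassiliev_of_type n V \<longleftrightarrow> link_invariant V \<and>
     (\<forall>L R x. singular_link L \<and> card (double_points L) > n \<and> is_resolution L R \<and>
        vassiliev_value V R (double_points L) (all_kept L) x \<longrightarrow> x = 0)"

definition vassiliev_invariant :: "(('l::finite) framed_curves \<Rightarrow> 'g::ab_group_add) \<Rightarrow> bool" where
  "vassiliev_invariant V \<longleftrightarrow> (\<exists>n. vassiliev_of_type n V)"


section \<open>Linking class invariants of finite type\<close>

text \<open>
  A pairing is a set of pairs of double points, the one labelled \<open>+\<close> first. By the two
  cardinalities below, the pairs are disjoint. Note that \<open>fst ` d\<close> is the set of components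
  meeting at \<open>d\<close>.
\<close>

type_synonym 'l pairing = "('l double_point \<times> 'l double_point) set"

definition DD_singular_link ::
  "nat \<Rightarrow> int^'l^'l \<Rightarrow> ('l::finite) framed_curves \<Rightarrow> 'l pairing \<Rightarrow> bool" where
  "DD_singular_link m P L pairs \<longleftrightarrow>
     singular_link L \<and> finite pairs \<and> card pairs = m \<and> card (double_points L) = 2 * m \<and>
     double_points L = fst ` pairs \<union> snd ` pairs \<and>
     (\<forall>(p, q) \<in> pairs. fst ` p = fst ` q) \<and>
     (\<forall>R. is_resolution L R \<longrightarrow>
        (\<forall>\<sigma> \<in> double_points L \<rightarrow>\<^sub>E {-1, 1}.
           (\<forall>(p, q) \<in> pairs. \<sigma> q = - \<sigma> p) \<longrightarrow> R \<sigma> \<in> P_links P))"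

text \<open>
  \<open>drawn L\<close>: stereographic projection to \<open>3\<close>-space followed by projection to the first two
  coordinates gives a diagram of \<open>L\<close>, and \<open>L\<close> carries the blackboard framing.
\<close>

definition shadow :: "real^3 \<Rightarrow> real \<times> real" where
  "shadow y = (y$1, y$2)"

definition diagram :: "'l framed_curves \<Rightarrow> 'l \<Rightarrow> real \<Rightarrow> real \<times> real" where
  "diagram L i t = shadow (stereo (pos L i t))"

definition diagram_velocity :: "'l framed_curves \<Rightarrow> 'l \<Rightarrow> real \<Rightarrow> real \<times> real" where
  "diagram_velocity L i t = vector_derivative (diagram L i) (at t)"

definition stereo_framing :: "'l framed_curves \<Rightarrow> 'l \<Rightarrow> real \<Rightarrow> real^3" where
  "stereo_framing L i t =
     vector_derivative (\<lambda>e. stereo (pos L i t + e *\<^sub>R framing L i t)) (at 0)"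

text \<open>The diagram crossings include the images of the double points.\<close>

definition diagram_crossings :: "'l framed_curves \<Rightarrow> 'l double_point set" where
  "diagram_crossings L = self_intersections (\<lambda>(i, t). diagram L i t)"

definition drawn :: "('l::finite) framed_curves \<Rightarrow> bool" where
  "drawn L \<longleftrightarrow>
     (\<forall>i t. pos L i t \<noteq> north_pole \<and> stereo_framing L i t $ 3 = 0 \<and>
        indep2 (diagram_velocity L i t) (shadow (stereo_framing L i t))) \<and>
     finite (diagram_crossings L) \<and> disjoint (diagram_crossings L) \<and>
     (\<forall>i s j t. {(i, s), (j, t)} \<in> diagram_crossings L \<longrightarrow>
        indep2 (diagram_velocity L i s) (diagram_velocity L j t))"

text \<open>
  In the drawing, an oriented segment of some component runs from \<open>q\<close> (labelled \<open>-\<close>) to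
  \<open>p\<close> (labelled \<open>+\<close>) without meeting a crossing or double point in its interior.
\<close>

definition close_pair ::
  "('l::finite) framed_curves \<Rightarrow> 'l double_point \<Rightarrow> 'l double_point \<Rightarrow> bool" where
  "close_pair L p q \<longleftrightarrow>
     (\<exists>i s t. s < t \<and> (i, frac s) \<in> q \<and> (i, frac t) \<in> p \<and>
        (\<forall>u\<in>{s<..<t}. (i, frac u) \<notin> \<Union> (diagram_crossings L)))"

definition wedge_singular_link ::
  "nat \<Rightarrow> int^'l^'l \<Rightarrow> ('l::finite) framed_curves \<Rightarrow> 'l pairing \<Rightarrow> bool" where
  "wedge_singular_link m P L pairs \<longleftrightarrow> DD_singular_link m P L pairs \<and>
     (\<exists>L'. isotopic L L' \<and> drawn L' \<and> (\<forall>(p, q) \<in> pairs. close_pair L' p q))"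

text \<open>
  The extension of \<open>V\<close> to singular links with paired double points, by
  \<open>V(L) = V(L with p positive, q negative) - V(L with p negative, q positive)\<close>
  for a pair \<open>(p, q)\<close> with labels \<open>(+, -)\<close>.
\<close>

inductive pair_value ::
  "('l framed_curves \<Rightarrow> 'g::ab_group_add) \<Rightarrow> ('l state \<Rightarrow> 'l framed_curves) \<Rightarrow>
   'l double_point set \<Rightarrow> 'l pairing \<Rightarrow> 'l state \<Rightarrow> 'g \<Rightarrow> bool"
  for V R D pairs where
  resolved: "\<sigma> \<in> D \<rightarrow>\<^sub>E {-1, 1} \<Longrightarrow> pair_value V R D pairs \<sigma> (V (R \<sigma>))"
| pair: "(p, q) \<in> pairs \<Longrightarrow> \<sigma> p = 0 \<Longrightarrow> \<sigma> q = 0 \<Longrightarrow>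
    pair_value V R D pairs (\<sigma>(p := 1, q := -1)) x \<Longrightarrow>
    pair_value V R D pairs (\<sigma>(p := -1, q := 1)) y \<Longrightarrow>
    pair_value V R D pairs \<sigma> (x - y)"

text \<open>Only the values of \<open>V\<close> on links with linking matrix \<open>P\<close> matter in the following.\<close>

definition linking_class_invariant ::
  "int^'l^'l \<Rightarrow> (('l::finite) framed_curves \<Rightarrow> 'g) \<Rightarrow> bool" where
  "linking_class_invariant P V \<longleftrightarrow>
     (\<forall>L\<in>P_links P. \<forall>L'\<in>P_links P. isotopic L L' \<longrightarrow> V L = V L')"

definition DD_finite_type ::
  "int^'l^'l \<Rightarrow> (('l::finite) framed_curves \<Rightarrow> 'g::ab_group_add) \<Rightarrow> bool" where
  "DD_finite_type P V \<longleftrightarrow> linking_class_invariant P V \<and>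
     (\<exists>m>0. \<forall>L pairs R x. DD_singular_link m P L pairs \<and> is_resolution L R \<and>
        pair_value V R (double_points L) pairs (all_kept L) x \<longrightarrow> x = 0)"

definition wedge_finite_type ::
  "int^'l^'l \<Rightarrow> (('l::finite) framed_curves \<Rightarrow> 'g::ab_group_add) \<Rightarrow> bool" where
  "wedge_finite_type P V \<longleftrightarrow> linking_class_invariant P V \<and>
     (\<exists>m>0. \<forall>L pairs R x. wedge_singular_link m P L pairs \<and> is_resolution L R \<and>
        pair_value V R (double_points L) pairs (all_kept L) x \<longrightarrow> x = 0)"

end

theory Submission
  imports Defs
begin

text \<open>
  For a pair \<open>(p, q)\<close> the two terms of the difference \<open>V(p+, q-) - V(p-, q+)\<close> are connected
  through \<open>V(p-, q-)\<close>, so the difference equals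
  \<open>V(p double, q-) - V(p-, q double)\<close>. Hence the value on a link with \<open>m\<close> pairs is a signed
  sum of \<open>2^m\<close> Vassiliev values on links with \<open>m\<close> double points each, and all of them vanish
  once \<open>m\<close> exceeds the type of \<open>V\<close>.
\<close>

section \<open>Alternating sums\<close>

text \<open>The values lie in a mere abelian group, so the sign (-1)^|A| is a case distinction on
  parity.\<close>

definition signed_sum :: "'a set \<Rightarrow> ('a set \<Rightarrow> 'g::ab_group_add) \<Rightarrow> 'g" where
  "signed_sum Z g = (\<Sum>A\<in>Pow Z. if even (card A) then g A else - g A)"

lemma signed_sum_empty [simp]: "signed_sum {} g = g {}"
  by (simp add: signed_sum_def)

lemma signed_sum_zero [simp]: "signed_sum Z (\<lambda>_. 0) = 0"
  by (simp add: signed_sum_def cong: if_cong)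

lemma signed_sum_cong:
  assumes "\<And>A. A \<subseteq> Z \<Longrightarrow> g A = h A"
  shows "signed_sum Z g = signed_sum Z h"
  unfolding signed_sum_def by (intro sum.cong) (auto simp: assms)

lemma signed_sum_diff:
  "signed_sum Z g - signed_sum Z h = signed_sum Z (\<lambda>A. g A - h A)"
  unfolding signed_sum_def sum_subtractf[symmetric] by (intro sum.cong) auto

text \<open>Split the subsets by whether they contain \<open>d\<close>; adding \<open>d\<close> to a
  subset flips its parity and hence its sign.\<close>

lemma signed_sum_insert:
  assumes "finite Z" "d \<notin> Z"
  shows "signed_sum (insert d Z) g = signed_sum Z g - signed_sum Z (\<lambda>A. g (insert d A))"
proof -
  let ?s = "\<lambda>A. if even (card A) then g A else - g A"
  have inj: "inj_on (insert d) (Pow Z)"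
    using assms(2) by (auto simp: inj_on_def)
  have "signed_sum (insert d Z) g = sum ?s (Pow Z) + sum ?s (insert d ` Pow Z)"
    unfolding signed_sum_def Pow_insert
    using assms by (intro sum.union_disjoint) auto
  also have "sum ?s (insert d ` Pow Z) = (\<Sum>A\<in>Pow Z. ?s (insert d A))"
    by (simp add: sum.reindex[OF inj])
  also have "\<dots> = (\<Sum>A\<in>Pow Z. - (if even (card A) then g (insert d A) else - g (insert d A)))"
  proof (intro sum.cong refl)
    fix A assume "A \<in> Pow Z"
    then have "finite A" "d \<notin> A"
      using assms finite_subset by auto
    then show "?s (insert d A) = - (if even (card A) then g (insert d A) else - g (insert d A))"
      by simp
  qed
  finally show ?thesis
    by (simp add: signed_sum_def sum_negf)
qed

section \<open>Sums over the total resolutions of a state\<close>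

definition zeros :: "'l double_point set \<Rightarrow> 'l state \<Rightarrow> 'l double_point set" where
  "zeros D \<sigma> = {d \<in> D. \<sigma> d = 0}"

text \<open>\<open>A\<close> holds the kept points that become negative crossings, so the parity of
  \<open>A\<close> is the sign of this resolution in the Vassiliev extension.\<close>

definition resolved_state :: "'l double_point set \<Rightarrow> 'l state \<Rightarrow> 'l double_point set \<Rightarrow> 'l state" where
  "resolved_state Z \<sigma> A = (\<lambda>e. if e \<in> A then -1 else if e \<in> Z then 1 else \<sigma> e)"

text \<open>A closed form for the inductive relation \<open>vassiliev_value\<close>. As a function
  of the state it does not depend on an order in which double points are resolved, so it can be
  expanded at any of them.\<close>

definition alternating_value ::
  "('l state \<Rightarrow> 'g::ab_group_add) \<Rightarrow> 'l double_point set \<Rightarrow> 'l state \<Rightarrow> 'g" where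
  "alternating_value f D \<sigma> = signed_sum (zeros D \<sigma>) (\<lambda>A. f (resolved_state (zeros D \<sigma>) \<sigma> A))"

lemma alternating_value_resolved:
  assumes "zeros D \<sigma> = {}"
  shows "alternating_value f D \<sigma> = f \<sigma>"
  by (simp add: alternating_value_def assms resolved_state_def)

lemma alternating_value_double_point:
  assumes "finite D" "d \<in> D" "\<sigma> d = 0"
  shows "alternating_value f D \<sigma> =
    alternating_value f D (\<sigma>(d := 1)) - alternating_value f D (\<sigma>(d := -1))"
proof -
  define Z where "Z = zeros D \<sigma> - {d}"
  have Z: "zeros D \<sigma> = insert d Z" "zeros D (\<sigma>(d := 1)) = Z" "zeros D (\<sigma>(d := -1)) = Z"
    using assms by (auto simp: Z_def zeros_def)
  have fin: "finite Z" "d \<notin> Z"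
    using assms(1) by (auto simp: Z_def zeros_def)
  have plus: "resolved_state (insert d Z) \<sigma> A = resolved_state Z (\<sigma>(d := 1)) A"
    and minus: "resolved_state (insert d Z) \<sigma> (insert d A) = resolved_state Z (\<sigma>(d := -1)) A"
    if "A \<subseteq> Z" for A
    using fin(2) that by (auto simp: resolved_state_def)
  show ?thesis
    unfolding alternating_value_def Z signed_sum_insert[OF fin]
    by (intro arg_cong2[where f = minus] signed_sum_cong) (simp_all add: plus minus)
qed

text \<open>\<open>vassiliev_of_type\<close> only constrains values that have a derivation. This
  provides one for the closed form, by induction on the number of kept double points.\<close>

lemma alternating_value_vassiliev:
  assumes "finite D" "\<tau> \<in> D \<rightarrow>\<^sub>E {-1, 0, 1}"
  shows "vassiliev_value V R D \<tau> (alternating_value (\<lambda>\<rho>. V (R \<rho>)) D \<tau>)"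
  using assms(2)
proof (induction "card (zeros D \<tau>)" arbitrary: \<tau> rule: less_induct)
  case less
  show ?case
  proof (cases "zeros D \<tau> = {}")
    case True
    have "\<tau> d \<in> {-1, 1}" if "d \<in> D" for d
      using PiE_mem[OF less.prems that] True that by (auto simp: zeros_def)
    then have "\<tau> \<in> D \<rightarrow>\<^sub>E {-1, 1}"
      using less.prems by (simp add: PiE_iff)
    then show ?thesis
      using vassiliev_value.resolved[of \<tau> D V R] by (simp add: alternating_value_resolved True)
  next
    case False
    then obtain d where d: "d \<in> D" "\<tau> d = 0"
      by (auto simp: zeros_def)
    have fin: "finite (zeros D \<tau>)"
      using assms(1) by (simp add: zeros_def)
    have sub: "zeros D (\<tau>(d := c)) \<subset> zeros D \<tau>" if "c \<noteq> 0" for c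
      using d that by (auto simp: zeros_def)
    have "vassiliev_value V R D (\<tau>(d := c)) (alternating_value (\<lambda>\<rho>. V (R \<rho>)) D (\<tau>(d := c)))"
      if "c \<in> {-1, 1}" for c
    proof (rule less.hyps)
      show "card (zeros D (\<tau>(d := c))) < card (zeros D \<tau>)"
        using that by (intro psubset_card_mono[OF fin] sub) auto
      show "\<tau>(d := c) \<in> D \<rightarrow>\<^sub>E {-1, 0, 1}"
        using less.prems d(1) that by (auto simp: PiE_iff extensional_def)
    qed
    from vassiliev_value.double_point[OF d this[of 1] this[of "-1"]] show ?thesis
      by (simp add: alternating_value_double_point[of D d \<tau>, OF assms(1) d])
  qed
qed


section \<open>Partial resolutions\<close>

lemma crossing_change_endpoints:
  assumes "crossing_change d Lm L Lp"
  shows "singular_link Lm" "double_points Lm = double_points L - {d}"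
    "singular_link Lp" "double_points Lp = double_points L - {d}"
proof -
  obtain H where H: "H (-1) = Lm" "H 1 = Lp"
    "\<forall>e\<in>{-1..1::real}. singular_link (H e) \<and>
       (e \<noteq> 0 \<longrightarrow> double_points (H e) = double_points L - {d})"
    using assms unfolding crossing_change_def by blast
  from H(3)[rule_format, of "-1"] H(3)[rule_format, of 1] H(1,2)
  show "singular_link Lm" "double_points Lm = double_points L - {d}"
    "singular_link Lp" "double_points Lp = double_points L - {d}" by auto
qed

text \<open>Induction on the number of replaced double points: undoing one replacement gives a state
  \<open>\<rho>\<close>, and \<open>R \<sigma>\<close> is an end of the crossing change at
  \<open>R \<rho>\<close>, which removes just that double point.\<close>

lemma resolution_double_points:
  assumes "is_resolution L R" "singular_link L"
    and "\<sigma> \<in> double_points L \<rightarrow>\<^sub>E {-1, 0, 1}"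
  shows "singular_link (R \<sigma>) \<and> double_points (R \<sigma>) = zeros (double_points L) \<sigma>"
  using assms(3)
proof (induction "card (double_points L - zeros (double_points L) \<sigma>)" arbitrary: \<sigma> rule: less_induct)
  case less
  let ?D = "double_points L"
  have fin: "finite ?D"
    using assms(2) by (simp add: singular_link_def)
  show ?case
  proof (cases "zeros ?D \<sigma> = ?D")
    case True
    then have "\<sigma> = all_kept L"
      using less.prems by (auto simp: all_kept_def zeros_def PiE_iff extensional_def fun_eq_iff)
    then show ?thesis
      using assms(1,2) True by (simp add: is_resolution_def)
  next
    case False
    then obtain d where d: "d \<in> ?D" "\<sigma> d \<noteq> 0"
      by (auto simp: zeros_def)
    define \<rho> where "\<rho> = \<sigma>(d := 0)"
    have \<rho>: "\<rho> \<in> ?D \<rightarrow>\<^sub>E {-1, 0, 1}" "\<rho> d = 0" "zeros ?D \<rho> = insert d (zeros ?D \<sigma>)"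
      using less.prems d by (auto simp: \<rho>_def zeros_def PiE_iff extensional_def)
    have "?D - zeros ?D \<rho> \<subset> ?D - zeros ?D \<sigma>"
      using d unfolding \<rho>(3) by (auto simp: zeros_def)
    then have "card (?D - zeros ?D \<rho>) < card (?D - zeros ?D \<sigma>)"
      using fin by (intro psubset_card_mono) auto
    from less.hyps[OF this \<rho>(1)] have IH: "double_points (R \<rho>) = zeros ?D \<rho>" by simp
    have "crossing_change d (R (\<rho>(d := -1))) (R \<rho>) (R (\<rho>(d := 1)))"
      using assms(1) \<rho>(1,2) d(1) unfolding is_resolution_def by blast
    note ends = crossing_change_endpoints[OF this]
    have "\<sigma> d = -1 \<or> \<sigma> d = 1"
      using less.prems d by (auto simp: PiE_iff)
    then have "\<sigma> = \<rho>(d := -1) \<or> \<sigma> = \<rho>(d := 1)"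
      unfolding \<rho>_def by (metis fun_upd_triv fun_upd_upd)
    then have "singular_link (R \<sigma>) \<and> double_points (R \<sigma>) = double_points (R \<rho>) - {d}"
      using ends by metis
    moreover have "zeros ?D \<rho> - {d} = zeros ?D \<sigma>"
      using d(2) unfolding \<rho>(3) by (auto simp: zeros_def)
    ultimately show ?thesis
      by (simp add: IH)
  qed
qed

text \<open>A partial resolution \<open>R \<sigma>\<close> is itself a singular link, and
  \<open>R\<close> with the replaced points frozen as in \<open>\<sigma>\<close> is a resolution of
  it. Thus the type condition applies to \<open>R \<sigma>\<close>.\<close>

lemma vassiliev_vanishes_at_state:
  fixes V :: "('l::finite) framed_curves \<Rightarrow> 'g::ab_group_add"
  assumes V: "vassiliev_of_type n V" and R: "is_resolution L R" and L: "singular_link L"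
    and \<sigma>: "\<sigma> \<in> double_points L \<rightarrow>\<^sub>E {-1, 0, 1}"
    and n: "card (zeros (double_points L) \<sigma>) > n"
  shows "alternating_value (\<lambda>\<rho>. V (R \<rho>)) (double_points L) \<sigma> = 0"
proof -
  define D where "D = double_points L"
  define Z where "Z = zeros D \<sigma>"
  define ext :: "'l state \<Rightarrow> 'l state" where "ext = (\<lambda>\<tau> e. if e \<in> Z then \<tau> e else \<sigma> e)"
  have dp: "singular_link (R \<sigma>)" "double_points (R \<sigma>) = Z"
    using resolution_double_points[OF R L \<sigma>] by (auto simp: Z_def D_def)
  have Z: "finite Z" "Z \<subseteq> D"
    using L by (auto simp: Z_def D_def zeros_def singular_link_def)
  have kept: "ext (all_kept (R \<sigma>)) = \<sigma>"
    by (auto simp: ext_def all_kept_def dp Z_def zeros_def fun_eq_iff)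
  have ext_upd: "ext (\<tau>(d := c)) = (ext \<tau>)(d := c)" if "d \<in> Z" for \<tau> d c
    using that by (auto simp: ext_def fun_eq_iff)
  have ext_state: "ext \<tau> \<in> D \<rightarrow>\<^sub>E {-1, 0, 1}" if "\<tau> \<in> Z \<rightarrow>\<^sub>E {-1, 0, 1}" for \<tau>
    using that \<sigma> Z(2) by (auto simp: ext_def D_def PiE_iff extensional_def)
  have res: "is_resolution (R \<sigma>) (\<lambda>\<tau>. R (ext \<tau>))"
    unfolding is_resolution_def
  proof (intro conjI ballI impI)
    show "R (ext (all_kept (R \<sigma>))) = R \<sigma>"
      by (simp add: kept)
  next
    fix \<tau> :: "'l state" and d assume "\<tau> \<in> double_points (R \<sigma>) \<rightarrow>\<^sub>E {-1, 0, 1}" "d \<in> double_points (R \<sigma>)" "\<tau> d = 0"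
    then have \<tau>: "\<tau> \<in> Z \<rightarrow>\<^sub>E {-1, 0, 1}" and d: "d \<in> Z" "\<tau> d = 0"
      by (simp_all add: dp)
    have "ext \<tau> d = 0" "d \<in> D"
      using d Z(2) by (auto simp: ext_def)
    then show "crossing_change d (R (ext (\<tau>(d := -1)))) (R (ext \<tau>)) (R (ext (\<tau>(d := 1))))"
      using R ext_state[OF \<tau>] unfolding is_resolution_def ext_upd[OF d(1)] D_def by blast
  qed
  have "all_kept (R \<sigma>) \<in> Z \<rightarrow>\<^sub>E {-1, 0, 1}"
    by (auto simp: all_kept_def dp)
  from alternating_value_vassiliev[OF Z(1) this, of V "\<lambda>\<tau>. R (ext \<tau>)"]
  have vanish: "alternating_value (\<lambda>\<rho>. V (R (ext \<rho>))) Z (all_kept (R \<sigma>)) = 0"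
    using V dp n res unfolding vassiliev_of_type_def Z_def D_def by metis
  have zeros_kept: "zeros Z (all_kept (R \<sigma>)) = Z"
    by (auto simp: zeros_def all_kept_def dp)
  have resolved: "resolved_state Z \<sigma> A = ext (resolved_state Z (all_kept (R \<sigma>)) A)" if "A \<subseteq> Z" for A
    using that by (auto simp: ext_def resolved_state_def fun_eq_iff)
  have "alternating_value (\<lambda>\<rho>. V (R \<rho>)) D \<sigma> =
      alternating_value (\<lambda>\<rho>. V (R (ext \<rho>))) Z (all_kept (R \<sigma>))"
    unfolding alternating_value_def zeros_kept Z_def[symmetric]
    by (intro signed_sum_cong) (simp add: resolved)
  then show ?thesis
    by (simp add: vanish D_def)
qed


section \<open>Values on paired double points\<close>

text \<open>Testing \<open>p\<close> alone suffices for states with opposite values on each pair,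
  since then \<open>q\<close> is kept whenever \<open>p\<close> is.\<close>

definition zero_pairs :: "'l pairing \<Rightarrow> 'l state \<Rightarrow> 'l pairing" where
  "zero_pairs pairs \<sigma> = {(p, q) \<in> pairs. \<sigma> p = 0}"

text \<open>For pairs in \<open>A\<close> the second double point is kept, for the other pairs in \<open>Z\<close> the first one.\<close>

definition half_resolved :: "'l pairing \<Rightarrow> 'l state \<Rightarrow> 'l pairing \<Rightarrow> 'l state" where
  "half_resolved Z \<sigma> A = (\<lambda>e. if e \<in> fst ` A \<union> snd ` (Z - A) then -1 else \<sigma> e)"

text \<open>Induction on the derivation of the pair value, telescoping one pair at a time.
  \<open>V \<circ> R\<close> and \<open>f\<close> are kept apart because they need agree only at
  resolutions with opposite signs on every pair, whereas the intermediate states also lead to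
  resolutions with equal signs on a pair.\<close>

lemma pair_value_half_resolved:
  assumes fin: "finite D" "finite pairs"
    and inj: "inj_on fst pairs" "inj_on snd pairs" and disj: "fst ` pairs \<inter> snd ` pairs = {}"
    and D: "D = fst ` pairs \<union> snd ` pairs"
    and f: "\<And>\<sigma>. \<sigma> \<in> D \<rightarrow>\<^sub>E {-1, 1} \<Longrightarrow> \<forall>(p, q) \<in> pairs. \<sigma> q = - \<sigma> p \<Longrightarrow> V (R \<sigma>) = f \<sigma>"
    and "pair_value V R D pairs \<sigma> x" "\<forall>(p, q) \<in> pairs. \<sigma> q = - \<sigma> p"
  shows "x = signed_sum (zero_pairs pairs \<sigma>)
    (\<lambda>A. alternating_value f D (half_resolved (zero_pairs pairs \<sigma>) \<sigma> A))"
proof -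
  have cross: "a \<noteq> d" if "(a, b) \<in> pairs" "(c, d) \<in> pairs" for a b c d
    using imageI[OF that(1), of fst] imageI[OF that(2), of snd] disj by auto
  have mem: "a \<in> D" "b \<in> D" "a \<noteq> b" if "(a, b) \<in> pairs" for a b
    using imageI[OF that, of fst] imageI[OF that, of snd] cross[OF that that] by (simp_all add: D)
  show ?thesis
    using assms(8,9)
  proof (induction rule: pair_value.induct)
    case (resolved \<sigma>)
    have nonzero: "\<sigma> d \<noteq> 0" if "d \<in> D" for d
      using PiE_mem[OF resolved(1) that] by auto
    have "zero_pairs pairs \<sigma> = {}" "zeros D \<sigma> = {}"
      using nonzero mem by (auto simp: zero_pairs_def zeros_def)
    then show ?case
      using resolved by (simp add: half_resolved_def alternating_value_resolved f)
  next
    case (pair p q \<sigma> x y)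
    define Z where "Z = zero_pairs pairs \<sigma> - {(p, q)}"
    have pD: "p \<in> D" "q \<in> D" "p \<noteq> q"
      using mem[OF pair.hyps(1)] by simp_all
    \<comment> \<open>Distinct pairs share no double point: injectivity excludes coincidences in the
      same position, \<open>cross\<close> those in opposite positions. So updates at
      \<open>p\<close> and \<open>q\<close> leave the other pairs alone.\<close>
    have away: "a \<noteq> p \<and> a \<noteq> q \<and> b \<noteq> p \<and> b \<noteq> q" if "(a, b) \<in> pairs" "(a, b) \<noteq> (p, q)" for a b
      using that(2) inj_onD[OF inj(1) _ that(1) pair.hyps(1)] inj_onD[OF inj(2) _ that(1) pair.hyps(1)]
        cross[OF pair.hyps(1) that(1)] cross[OF that(1) pair.hyps(1)] by auto
    have Z: "zero_pairs pairs \<sigma> = insert (p, q) Z" "(p, q) \<notin> Z" "Z \<subseteq> pairs" "finite Z"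
      using pair.hyps fin(2) by (auto simp: Z_def zero_pairs_def intro: finite_subset)
    have Z_upd: "zero_pairs pairs (\<sigma>(p := c, q := -c)) = Z" if "c \<noteq> 0" for c
    proof -
      have "(\<sigma>(p := c, q := -c)) a = 0 \<longleftrightarrow> \<sigma> a = 0 \<and> (a, b) \<noteq> (p, q)" if "(a, b) \<in> pairs" for a b
        using away[OF that] pD(3) \<open>c \<noteq> 0\<close> by (cases "(a, b) = (p, q)") simp_all
      then show ?thesis
        unfolding Z_def zero_pairs_def by blast
    qed
    \<comment> \<open>Opposite values on each pair form the invariant of the induction; at total
      resolutions it makes the assumption on \<open>f\<close> applicable.\<close>
    have anti: "\<forall>(a, b) \<in> pairs. (\<sigma>(p := c, q := -c)) b = - (\<sigma>(p := c, q := -c)) a" for c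
    proof clarify
      fix a b assume ab: "(a, b) \<in> pairs"
      then have "\<sigma> b = - \<sigma> a"
        using pair.prems by auto
      then show "(\<sigma>(p := c, q := -c)) b = - (\<sigma>(p := c, q := -c)) a"
        using away[OF ab] pD(3) by (cases "(a, b) = (p, q)") simp_all
    qed
    have not_mem: "p \<notin> fst ` A \<union> snd ` B" "q \<notin> fst ` A \<union> snd ` B" if "A \<subseteq> Z" "B \<subseteq> Z" for A B
    proof -
      have "a \<notin> {p, q}" "b \<notin> {p, q}" if "(a, b) \<in> Z" for a b
        using away[of a b] that Z(2,3) by blast+
      then have "fst ` Z \<union> snd ` Z \<subseteq> - {p, q}"
        by (simp add: subset_iff image_iff Bex_def) blast
      moreover have "fst ` A \<union> snd ` B \<subseteq> fst ` Z \<union> snd ` Z"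
        by (intro Un_mono image_mono that)
      ultimately have sub: "fst ` A \<union> snd ` B \<subseteq> - {p, q}"
        by (rule subset_trans[rotated])
      show "p \<notin> fst ` A \<union> snd ` B" "q \<notin> fst ` A \<union> snd ` B"
        using subsetD[OF sub, of p] subsetD[OF sub, of q] by auto
    qed
    have minus_one_neq_zero: "(-1::int) \<noteq> 0"
      by simp
    have x: "x = signed_sum Z (\<lambda>A. alternating_value f D (half_resolved Z (\<sigma>(p := 1, q := -1)) A))"
      using pair.IH(1)[OF anti[of 1]] unfolding Z_upd[of 1, OF one_neq_zero] .
    have y: "y = signed_sum Z (\<lambda>A. alternating_value f D (half_resolved Z (\<sigma>(p := -1, q := 1)) A))"
      using pair.IH(2)[OF anti[of "-1", unfolded minus_minus]]
      unfolding Z_upd[of "-1", unfolded minus_minus, OF minus_one_neq_zero] .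
    show ?case
      unfolding x y Z(1) signed_sum_insert[OF Z(4,2)] signed_sum_diff
    proof (rule signed_sum_cong)
      fix A assume A: "A \<subseteq> Z"
      define \<rho> where "\<rho> = half_resolved Z \<sigma> A"
      let ?a = "alternating_value f D"
      have nm: "p \<notin> fst ` A" "p \<notin> snd ` (Z - A)" "q \<notin> fst ` A" "q \<notin> snd ` (Z - A)"
        using not_mem[OF A, of "Z - A"] by simp_all
      have \<rho>0: "\<rho> p = 0" "\<rho> q = 0"
        using nm pair.hyps(2,3) by (simp_all add: \<rho>_def half_resolved_def)
      have upd: "half_resolved Z (\<sigma>(p := b, q := c)) A = \<rho>(p := b, q := c)" for b c
        using nm by (simp add: \<rho>_def half_resolved_def fun_eq_iff)
      \<comment> \<open>A set without \<open>(p, q)\<close> makes \<open>q\<close> negative and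
        keeps \<open>p\<close>; adding \<open>(p, q)\<close> exchanges these roles and brings in the
        minus sign.\<close>
      have "insert (p, q) Z - A = insert (p, q) (Z - A)" "insert (p, q) Z - insert (p, q) A = Z - A"
        using A Z(2) by auto
      then have out: "half_resolved (insert (p, q) Z) \<sigma> A = \<rho>(q := -1)"
        and ins: "half_resolved (insert (p, q) Z) \<sigma> (insert (p, q) A) = \<rho>(p := -1)"
        by (auto simp: half_resolved_def \<rho>_def fun_eq_iff)
      \<comment> \<open>Expanding the first state at \<open>p\<close> and the second at
        \<open>q\<close> produces the same term, with both points negative; it cancels in the
        difference.\<close>
      have "?a (\<rho>(q := -1)) = ?a (\<rho>(p := 1, q := -1)) - ?a (\<rho>(p := -1, q := -1))"
        using alternating_value_double_point[of D p "\<rho>(q := -1)" f] fin(1) pD \<rho>0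
        by (simp add: fun_upd_twist[of q p])
      moreover have "?a (\<rho>(p := -1)) = ?a (\<rho>(p := -1, q := 1)) - ?a (\<rho>(p := -1, q := -1))"
        using alternating_value_double_point[of D q "\<rho>(p := -1)" f] fin(1) pD \<rho>0 by simp
      ultimately show "?a (half_resolved Z (\<sigma>(p := 1, q := -1)) A)
          - ?a (half_resolved Z (\<sigma>(p := -1, q := 1)) A) =
        ?a (half_resolved (insert (p, q) Z) \<sigma> A)
          - ?a (half_resolved (insert (p, q) Z) \<sigma> (insert (p, q) A))"
        by (simp add: upd out ins)
    qed
  qed
qed

text \<open>Both projections have at most \<open>card pairs\<close> elements, so a union of twice
  that size forces equality in both bounds and an empty intersection.\<close>

lemma pairing_injective_disjoint:
  assumes "finite pairs" "card (fst ` pairs \<union> snd ` pairs) = 2 * card pairs"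
  shows "inj_on fst pairs" "inj_on snd pairs" "fst ` pairs \<inter> snd ` pairs = {}"
proof -
  have "card (fst ` pairs) \<le> card pairs" "card (snd ` pairs) \<le> card pairs"
    using assms(1) card_image_le by auto
  moreover have "card (fst ` pairs) + card (snd ` pairs) =
      card (fst ` pairs \<union> snd ` pairs) + card (fst ` pairs \<inter> snd ` pairs)"
    using assms(1) by (intro card_Un_Int) auto
  ultimately have "card (fst ` pairs) = card pairs" "card (snd ` pairs) = card pairs"
    "card (fst ` pairs \<inter> snd ` pairs) = 0"
    using assms(2) by linarith+
  then show "inj_on fst pairs" "inj_on snd pairs" "fst ` pairs \<inter> snd ` pairs = {}"
    using assms(1) by (simp_all add: eq_card_imp_inj_on)
qed

text \<open>In each summand every pair retains a double point, so at least \<open>m > n\<close>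
  remain. The telescoped sum uses the unrestricted \<open>V\<close>, as its terms may leave the
  class of links with linking matrix \<open>P\<close>.\<close>

lemma DD_vanishing:
  assumes V: "vassiliev_of_type n V" and "m > n"
    and DD: "DD_singular_link m P L pairs" and R: "is_resolution L R"
    and x: "pair_value (restrict V (P_links P)) R (double_points L) pairs (all_kept L) x"
  shows "x = 0"
proof -
  define D where "D = double_points L"
  have L: "singular_link L" and pairs: "finite pairs" "card pairs = m"
    and D: "D = fst ` pairs \<union> snd ` pairs" and card_D: "card D = 2 * m"
    using DD[unfolded DD_singular_link_def, folded D_def] by - (elim conjE, assumption)+
  have links: "R \<sigma> \<in> P_links P"
    if "\<sigma> \<in> D \<rightarrow>\<^sub>E {-1, 1}" "\<forall>(p, q) \<in> pairs. \<sigma> q = - \<sigma> p" for \<sigma>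
    using DD R that unfolding DD_singular_link_def D_def by simp
  have fin: "finite D"
    using pairs(1) D by simp
  note inj = pairing_injective_disjoint[OF pairs(1), unfolded pairs(2) D[symmetric], OF card_D]
  have kept: "all_kept L e = 0" if "e \<in> D" for e
    using that by (simp add: all_kept_def D_def)
  have pairs_D: "fst d \<in> D" "snd d \<in> D" if "d \<in> pairs" for d
    using that by (simp_all add: D)
  \<comment> \<open>At the start both points of a pair are kept, and 0 = -0.\<close>
  have anti: "\<forall>(p, q) \<in> pairs. all_kept L q = - all_kept L p"
    by (simp add: split_beta kept pairs_D)
  have Z: "zero_pairs pairs (all_kept L) = pairs"
    by (auto simp: zero_pairs_def kept dest: pairs_D(1))
  have "x = signed_sum pairs
      (\<lambda>A. alternating_value (\<lambda>\<rho>. V (R \<rho>)) D (half_resolved pairs (all_kept L) A))"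
    using pair_value_half_resolved[OF fin pairs(1) inj D _ x[folded D_def] anti, of "\<lambda>\<rho>. V (R \<rho>)"]
    by (simp add: links Z)
  also have "\<dots> = signed_sum pairs (\<lambda>A. 0)"
  proof (rule signed_sum_cong)
    fix A assume A: "A \<subseteq> pairs"
    let ?\<sigma> = "half_resolved pairs (all_kept L) A"
    have "fst ` A \<union> snd ` (pairs - A) \<subseteq> D"
      using A by (auto simp: D)
    then have \<sigma>: "?\<sigma> \<in> D \<rightarrow>\<^sub>E {-1, 0, 1}"
      using kept by (auto simp: half_resolved_def PiE_iff extensional_def all_kept_def D_def)
    have "zeros D ?\<sigma> = D - (fst ` A \<union> snd ` (pairs - A))"
      using kept by (auto simp: zeros_def half_resolved_def)
    \<comment> \<open>One point is replaced per pair, so at most \<open>m\<close> of the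
      \<open>2 * m\<close> double points are lost.\<close>
    moreover have "card (fst ` A \<union> snd ` (pairs - A)) \<le> card A + card (pairs - A)"
      using A pairs(1) by (meson add_mono card_Un_le card_image_le finite_Diff finite_subset le_trans)
    moreover have "card A + card (pairs - A) = m"
      using A pairs by (metis card_Diff_subset card_mono finite_subset le_add_diff_inverse)
    ultimately have "card (zeros D ?\<sigma>) \<ge> m"
      using diff_card_le_card_Diff[of "fst ` A \<union> snd ` (pairs - A)" D] A pairs(1) card_D
      by (auto simp: finite_subset)
    then show "alternating_value (\<lambda>\<rho>. V (R \<rho>)) D ?\<sigma> = 0"
      using vassiliev_vanishes_at_state[OF V R L] \<sigma> \<open>m > n\<close> unfolding D_def by simp
  qed
  finally show ?thesis
    by simp
qed

theorem theorem1p5: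
  fixes V :: "('l::finite) framed_curves \<Rightarrow> 'g::ab_group_add"
    and P :: "int^'l^'l"
  assumes "vassiliev_invariant V"
    and "transpose P = P"
  shows "DD_finite_type P (restrict V (P_links P)) \<and>
         wedge_finite_type P (restrict V (P_links P))"
proof -
  obtain n where n: "vassiliev_of_type n V"
    using assms(1) by (auto simp: vassiliev_invariant_def)
  then have "linking_class_invariant P (restrict V (P_links P))"
    by (auto simp: vassiliev_of_type_def link_invariant_def linking_class_invariant_def P_links_def)
  \<comment> \<open>The same \<open>m = Suc n\<close> serves both notions, because a wedge-singular
    link is in particular DD-singular; it is positive even for type 0.\<close>
  moreover have "Suc n > 0" "Suc n > n"
    by simp_all
  ultimately show ?thesis
    using DD_vanishing[OF n]
    unfolding DD_finite_type_def wedge_finite_type_def wedge_singular_link_def by blast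
qed

end
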